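(* There exist two non-isomorphic MIF$(4)$'s each having exactly $42$ blocks.
   Context: A family is a non-empty set of non-empty finite sets, called its blocks. The point set of a family $\mathcal{G}$ is $P_{\mathcal{G}}=\bigcup_{B\in\mathcal{G}}B$. A family is uniform if all its blocks have the same size, denoted $\mathrm{k}(\mathcal{G})$. A blocking set of $\mathcal{G}$ is a set meeting every block of $\mathcal{G}$. If $\mathcal{G}$ has a finite blocking set, $\mathrm{tr}(\mathcal{G})$ is the smallest size of a blocking set, a transversal is a blocking set of size $\mathrm{tr}(\mathcal{G})$, and $\mathcal{G}^{\top}$ is the family of all transversals of $\mathcal{G}$; otherwise $\mathrm{tr}(\mathcal{G})=\infty$. A MIF$(k)$ is a uniform family $\mathcal{F}$ with $\mathrm{k}(\mathcal{F})=k$, $\mathrm{tr}(\mathcal{F})<\infty$ and $\mathcal{F}=\mathcal{F}^{\top}$. Families $\mathcal{G}$ and $\mathcal{H}$ are isomorphic if there is a bijection $\phi:P_{\mathcal{G}}\to P_{\mathcal{H}}$ such that $\phi(B)\in\mathcal{H}$ if and only if $B\in\mathcal{G}$. *)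

theory Defs
  imports Main "HOL-Library.Extended_Nat"
begin

definition is_family :: "'a set set \<Rightarrow> bool" where
  "is_family G \<longleftrightarrow> G \<noteq> {} \<and> (\<forall>B\<in>G. finite B \<and> B \<noteq> {})"

definition point_set :: "'a set set \<Rightarrow> 'a set" where
  "point_set G = \<Union> G"

definition uniform :: "'a set set \<Rightarrow> bool" where
  "uniform G \<longleftrightarrow> (\<forall>B\<in>G. \<forall>C\<in>G. card B = card C)"

(* Well defined only when G is non-empty and uniform. *)
definition block_size :: "'a set set \<Rightarrow> nat" where
  "block_size G = (THE k. \<forall>B\<in>G. card B = k)"

definition blocking_set :: "'a set set \<Rightarrow> 'a set \<Rightarrow> bool" where
  "blocking_set G T \<longleftrightarrow> (\<forall>B\<in>G. T \<inter> B \<noteq> {})"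

definition tr :: "'a set set \<Rightarrow> enat" where
  "tr G = (if \<exists>T. finite T \<and> blocking_set G T
           then enat (LEAST n. \<exists>T. finite T \<and> blocking_set G T \<and> card T = n)
           else \<infinity>)"

(* Finiteness of T is explicit because card is 0 on infinite sets. *)
definition transversals :: "'a set set \<Rightarrow> 'a set set" where
  "transversals G = {T. finite T \<and> blocking_set G T \<and> enat (card T) = tr G}"

definition MIF :: "nat \<Rightarrow> 'a set set \<Rightarrow> bool" where
  "MIF k F \<longleftrightarrow> is_family F \<and> uniform F \<and> block_size F = k \<and> tr F < \<infinity> \<and> F = transversals F"

definition isomorphic :: "'a set set \<Rightarrow> 'b set set \<Rightarrow> bool" where
  "isomorphic G H \<longleftrightarrow>
    (\<exists>\<phi>. bij_betw \<phi> (point_set G) (point_set H) \<and>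
         (\<forall>B. B \<subseteq> point_set G \<longrightarrow> (\<phi> ` B \<in> H \<longleftrightarrow> B \<in> G)))"

end

theory Submission
  imports Defs
begin

text \<open>
  Both families live on ten points. The first is a cone: six pairwise meeting blocks of
  size 4 that have no blocking set of size 2, together with all sets \<open>{0} \<union> t\<close> where \<open>t\<close>
  is one of their 36 blocking triples. The second joins a pair from \<open>{0,1,2}\<close> to an edge
  of a graph on \<open>{3,\<dots>,9}\<close> (the complete bipartite graph between \<open>{3,4,5,6}\<close> and
  \<open>{7,8,9}\<close> plus the edge \<open>{3,4}\<close>), and adds the three minimum vertex covers of that
  graph. The first has a point on 36 blocks, the second has none on more than 26.
\<close>

definition meets :: "'a list \<Rightarrow> 'a list \<Rightarrow> bool" where
  "meets xs ys \<longleftrightarrow> (\<exists>x\<in>set xs. x \<in> set ys)"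

lemma meets_iff: "meets xs ys \<longleftrightarrow> set xs \<inter> set ys \<noteq> {}"
  by (auto simp: meets_def)

text \<open>
  Branching search: a blocking set extending \<open>S\<close> by at most \<open>k\<close> points contains a point of
  the first block of \<open>R\<close>, the list of blocks not yet met. A branch left with
  unmet blocks after \<open>k\<close> points is dead, hence the value \<open>True\<close> there.
\<close>

primrec blocking_in ::
  "'a::linorder list list \<Rightarrow> nat \<Rightarrow> 'a list \<Rightarrow> 'a list list \<Rightarrow> bool" where
  "blocking_in L 0 S R \<longleftrightarrow> (case R of [] \<Rightarrow> sort S \<in> set L | _ \<Rightarrow> True)"
| "blocking_in L (Suc k) S R \<longleftrightarrow> (case R of [] \<Rightarrow> False
     | B # R' \<Rightarrow> (\<forall>x\<in>set B. blocking_in L k (x # S) (filter (\<lambda>C. x \<notin> set C) R')))"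

text \<open>Induction on \<open>k\<close>: \<open>T\<close> meets the first unmet block
  \<open>B\<close> in some \<open>x\<close>, which is new because \<open>S\<close> misses
  \<open>B\<close>, so the branch adding \<open>x\<close> stays inside \<open>T\<close>. At
  \<open>k = 0\<close> cardinality forces \<open>T = set S\<close>, and then no unmet block can
  remain.\<close>

lemma blocking_in_imp_mem:
  assumes "blocking_in L k S R" "finite T" "set S \<subseteq> T" "distinct S" "card T \<le> length S + k"
    and "\<forall>B\<in>set R. T \<inter> set B \<noteq> {}" "\<forall>B\<in>set R. set S \<inter> set B = {}"
  shows "T \<in> set ` set L"
  using assms
proof (induction k arbitrary: S R)
  case 0
  have "card (set S) = length S" using "0.prems"(4) by (rule distinct_card)
  then have T: "set S = T" using "0.prems"(2,3,5) by (intro card_seteq) auto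
  have "R = []" using "0.prems"(6,7) unfolding T by (cases R) auto
  then have "sort S \<in> set L" using "0.prems"(1) by simp
  then show ?case unfolding T[symmetric] by (metis imageI set_sort)
next
  \<comment> \<open>The search fails on an empty \<open>R\<close> with points to spare, so
    \<open>R\<close> has a first block.\<close>
  case (Suc k)
  then obtain B R' where R: "R = B # R'" by (cases R) auto
  obtain x where x: "x \<in> T" "x \<in> set B" using Suc.prems(6) R by auto
  have "x \<notin> set S" using Suc.prems(7) R x(2) by auto
  then show ?case
    using Suc.prems R x by (intro Suc.IH[of "x # S" "filter (\<lambda>C. x \<notin> set C) R'"]) auto
qed

definition check_MIF :: "nat \<Rightarrow> 'a::linorder list list \<Rightarrow> bool" where
  "check_MIF k L \<longleftrightarrow>
     (\<forall>ys\<in>set L. length ys = k \<and> sorted_wrt (<) ys \<and> (\<forall>zs\<in>set L. meets ys zs)) \<and>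
     blocking_in L k [] L"

text \<open>Pairwise meeting makes each block a blocking set of size \<open>k\<close>. The search
  makes each finite blocking set of size at most \<open>k\<close> a block, hence of size exactly
  \<open>k\<close>.\<close>

lemma MIF_if_check_MIF:
  assumes check: "check_MIF k L" and L: "L \<noteq> []" and k: "k > 0"
  shows "MIF k (set ` set L)"
proof -
  let ?F = "set ` set L"
  have card_block: "card B = k" if "B \<in> ?F" for B
    using that check unfolding check_MIF_def
    by (metis distinct_card imageE strict_sorted_iff)
  have block_blocking: "blocking_set ?F B" if "B \<in> ?F" for B
    using that check unfolding check_MIF_def meets_iff blocking_set_def by blast
  have blocking_mem: "T \<in> ?F" if T: "finite T" "blocking_set ?F T" "card T \<le> k" for T
  proof (rule blocking_in_imp_mem)
    show "blocking_in L k [] L" using check unfolding check_MIF_def by blast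
  qed (use T in \<open>auto simp: blocking_set_def\<close>)
  obtain B where B: "B \<in> ?F" using L by (cases L) auto
  have fin: "finite B" if "B \<in> ?F" for B using that by auto
  have "(LEAST n. \<exists>T. finite T \<and> blocking_set ?F T \<and> card T = n) = k"
  proof (rule Least_equality)
    show "\<exists>T. finite T \<and> blocking_set ?F T \<and> card T = k"
      using B fin block_blocking card_block by blast
    show "k \<le> n" if "\<exists>T. finite T \<and> blocking_set ?F T \<and> card T = n" for n
      using that blocking_mem card_block by (metis nat_le_linear)
  qed
  then have tr: "tr ?F = enat k"
    using B fin block_blocking unfolding tr_def by auto
  have "transversals ?F = ?F"
  proof (intro set_eqI iffI)
    show "T \<in> ?F" if "T \<in> transversals ?F" for T
      using that by (intro blocking_mem) (simp_all add: transversals_def tr)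
    show "T \<in> transversals ?F" if "T \<in> ?F" for T
      unfolding transversals_def tr using fin[OF that] block_blocking[OF that] card_block[OF that]
      by simp
  qed
  moreover have "block_size ?F = k"
    unfolding block_size_def
  proof (rule the_equality)
    show "\<forall>B\<in>?F. card B = k" using card_block by blast
    show "n = k" if "\<forall>B\<in>?F. card B = n" for n using bspec[OF that B] card_block[OF B] by simp
  qed
  moreover have "is_family ?F"
    unfolding is_family_def
  proof (intro conjI ballI)
    show "?F \<noteq> {}" using L by simp
    show "finite C" "C \<noteq> {}" if "C \<in> ?F" for C using fin[OF that] card_block[OF that] k by auto
  qed
  moreover have "uniform ?F" using card_block unfolding uniform_def by simp
  ultimately show ?thesis unfolding MIF_def using tr by simp
qed

text \<open>A strictly increasing list is determined by its set, so blocks can be counted on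
  lists.\<close>

lemma inj_on_set_if_check_MIF: "check_MIF k L \<Longrightarrow> inj_on set (set L)"
  unfolding check_MIF_def by (blast intro: inj_onI strict_sorted_equal)

lemma card_set_image:
  "check_MIF k L \<Longrightarrow> distinct L \<Longrightarrow> card (set ` set L) = length L"
  by (simp add: card_image inj_on_set_if_check_MIF distinct_card)

lemma card_blocks_through:
  assumes "check_MIF k L" "distinct L"
  shows "card {B \<in> set ` set L. x \<in> B} = length (filter (\<lambda>ys. x \<in> set ys) L)"
proof -
  have inj: "inj_on set (set (filter (\<lambda>ys. x \<in> set ys) L))"
    by (intro inj_on_subset[OF inj_on_set_if_check_MIF[OF assms(1)]]) auto
  have "{B \<in> set ` set L. x \<in> B} = set ` set (filter (\<lambda>ys. x \<in> set ys) L)"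
    by auto
  also have "card \<dots> = length (filter (\<lambda>ys. x \<in> set ys) L)"
    using inj assms(2) by (metis card_image distinct_card distinct_filter)
  finally show ?thesis .
qed

text \<open>Taking images under \<open>\<phi>\<close> embeds the blocks through \<open>x\<close>
  into those through \<open>\<phi> x\<close>.\<close>

lemma isomorphic_degree_le:
  assumes "isomorphic F G" "x \<in> point_set F" "finite G"
  obtains y where "y \<in> point_set G" "card {B \<in> F. x \<in> B} \<le> card {B \<in> G. y \<in> B}"
proof -
  obtain \<phi> where bij: "bij_betw \<phi> (point_set F) (point_set G)"
    and \<phi>: "\<And>B. B \<subseteq> point_set F \<Longrightarrow> \<phi> ` B \<in> G \<longleftrightarrow> B \<in> F"
    using assms(1) unfolding isomorphic_def by auto
  have sub: "B \<subseteq> point_set F" if "B \<in> F" for B using that by (auto simp: point_set_def)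
  have "card {B \<in> F. x \<in> B} \<le> card {B \<in> G. \<phi> x \<in> B}"
  proof (rule card_inj_on_le)
    show "inj_on ((`) \<phi>) {B \<in> F. x \<in> B}"
      using bij_betw_imp_inj_on[OF bij] sub by (auto intro!: inj_onI simp: inj_on_image_eq_iff)
    show "(`) \<phi> ` {B \<in> F. x \<in> B} \<subseteq> {B \<in> G. \<phi> x \<in> B}" using \<phi> sub by auto
    show "finite {B \<in> G. \<phi> x \<in> B}" using assms(3) by simp
  qed
  then show thesis using that bij_betwE[OF bij] assms(2) by blast
qed

text \<open>The triples come out increasing and the apex \<open>0\<close> lies below their entries,
  so all blocks are sorted as the check demands.\<close>

definition cone_family :: "nat list list" where
  "cone_family =
     (let C = [[1,2,3,8], [1,2,3,9], [2,4,5,6], [3,4,5,6], [5,7,8,9], [6,7,8,9]]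
      in C @ map ((#) 0)
        (filter (\<lambda>t. \<forall>ys\<in>set C. meets t ys) (filter (\<lambda>t. length t = 3) (subseqs [1..<10]))))"

text \<open>The edge \<open>[3,4]\<close> excludes the cover \<open>{7,8,9}\<close>, so minimum
  covers have four points. The 13 edges are exactly the pairs meeting all three covers.\<close>

definition graph_family :: "nat list list" where
  "graph_family =
     [[3,4,5,6], [3,7,8,9], [4,7,8,9]] @
     [p @ e. p \<leftarrow> [[0,1], [0,2], [1,2]], e \<leftarrow> [3,4] # List.product_lists [[3,4,5,6], [7,8,9]]]"

lemma cone_family_check:
  "check_MIF 4 cone_family" "distinct cone_family" "length cone_family = 42"
  "length (filter (\<lambda>ys. 0 \<in> set ys) cone_family) = 36"
  by code_simp+

text \<open>Each of 0, 1, 2 lies in two of the three pairs, hence on 2 * 13 = 26 blocks.\<close>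

lemma graph_family_check:
  "check_MIF 4 graph_family" "distinct graph_family" "length graph_family = 42"
  "\<forall>ys\<in>set graph_family. \<forall>y\<in>set ys. y \<in> set [0..<10]"
  "\<forall>y\<in>set [0..<10]. length (filter (\<lambda>ys. y \<in> set ys) graph_family) \<le> 26"
  by code_simp+

theorem mainTheorem4:
  "\<exists>(F :: nat set set) (G :: nat set set).
     MIF 4 F \<and> card F = 42 \<and> MIF 4 G \<and> card G = 42 \<and> \<not> isomorphic F G"
proof (intro exI conjI)
  let ?F = "set ` set cone_family" and ?G = "set ` set graph_family"
  have ne: "cone_family \<noteq> []" "graph_family \<noteq> []"
    using cone_family_check(3) graph_family_check(3) by auto
  show "MIF 4 ?F" by (rule MIF_if_check_MIF[OF cone_family_check(1) ne(1)]) simp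
  show "MIF 4 ?G" by (rule MIF_if_check_MIF[OF graph_family_check(1) ne(2)]) simp
  show "card ?F = 42"
    using card_set_image[OF cone_family_check(1,2)] cone_family_check(3) by simp
  show "card ?G = 42"
    using card_set_image[OF graph_family_check(1,2)] graph_family_check(3) by simp
  have degF: "card {B \<in> ?F. 0 \<in> B} = 36"
    unfolding card_blocks_through[OF cone_family_check(1,2)] by (rule cone_family_check(4))
  have degG: "card {B \<in> ?G. y \<in> B} \<le> 26" if "y \<in> point_set ?G" for y
  proof -
    have "y \<in> set [0..<10]"
      using that graph_family_check(4) unfolding point_set_def by blast
    then show ?thesis
      unfolding card_blocks_through[OF graph_family_check(1,2)] using graph_family_check(5) by blast
  qed
  show "\<not> isomorphic ?F ?G"
  proof
    assume iso: "isomorphic ?F ?G"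
    have "{B \<in> ?F. 0 \<in> B} \<noteq> {}" using degF by (metis card.empty zero_neq_numeral)
    then have "0 \<in> point_set ?F" unfolding point_set_def by blast
    then obtain y where "y \<in> point_set ?G" "card {B \<in> ?F. 0 \<in> B} \<le> card {B \<in> ?G. y \<in> B}"
      using isomorphic_degree_le[OF iso] by blast
    then show False using degF degG[of y] by linarith
  qed
qed

end
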